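(* (Hyperbolic Fischer--Hadamard inequality.) Let $P$ be a homogeneous PSD-stable lpm polynomial on real symmetric $n\times n$ matrices and let $\Pi$ be a partition of $[n]$. Then $$P(\pi_\Pi(A))\ \ge\ P(A)$$ holds for all $A\in H(P)$.
   Context: $X$ is a symmetric $n\times n$ matrix of indeterminates, and $X_J$ is its principal submatrix indexed by $J\subseteq[n]=\{1,\dots,n\}$ (with $\det X_\emptyset=1$). A linear principal minor polynomial (lpm polynomial) is a polynomial of the form $P(X)=\sum_{J\subseteq[n]}c_J\det(X_J)$ with $c_J\in\mathbb{R}$. A polynomial $P$ on symmetric matrices is PSD-stable if it has no zero among complex symmetric matrices with positive definite imaginary part. A homogeneous PSD-stable $P$ is hyperbolic with respect to the identity matrix $I$, i.e. $P(I)\neq0$ and $P(A-tI)$ has only real roots in $t$ for every real symmetric $A$; $H(P)$ is the set of real symmetric $A$ such that all roots of $P(A-tI)$ are nonnegative. For a partition $\Pi=\{S_1,\dots,S_m\}$ of $[n]$ write $i\sim j$ if $i,j$ lie in the same block, let $\mathcal{D}_\Pi$ be the space of real symmetric $n\times n$ matrices $A$ with $A_{ij}=0$ whenever $i\not\sim j$, and let $\pi_\Pi$ be the orthogonal projection of real symmetric matrices onto $\mathcal{D}_\Pi$ (it sets to zero all entries $A_{ij}$ with $i\not\sim j$).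
   Formalization: The formal theorem also assumes P(I) > 0; without a sign condition the claim is false (n = 2, P = −det, A the all-ones matrix, Π = {{1},{2}} gives P(π(A)) = −1 < 0 = P(A)). *)

theory Defs
  imports "HOL-Analysis.Analysis" "HOL-Library.Disjoint_Sets"
begin

(* The finite type 'n plays the role of [n]. *)

text \<open>The determinant of the principal submatrix \<open>A\<^sub>J\<close>, by the Leibniz formula over the
  permutations of the index set \<open>J\<close>: the definition of \<^const>\<open>det\<close> with \<open>UNIV\<close> replaced by \<open>J\<close>,
  since the size \<open>card J\<close> of the submatrix is not a type. Lemma \<open>pminor_eq_det\<close> below identifies it
  with the determinant of the actual submatrix.\<close>

definition pminor :: "'n::finite set \<Rightarrow> 'a::comm_ring_1 ^ 'n ^ 'n \<Rightarrow> 'a" where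
  "pminor J A = (\<Sum>p | p permutes J. of_int (sign p) * (\<Prod>i\<in>J. A $ i $ p i))"

text \<open>An lpm polynomial is given by its real coefficients \<open>c\<close>; the definition is polymorphic so that
  it can be evaluated both at real and at complex matrices.\<close>

definition lpm :: "('n::finite set \<Rightarrow> real) \<Rightarrow> 'a::{comm_ring_1, real_algebra_1} ^ 'n ^ 'n \<Rightarrow> 'a" where
  "lpm c A = (\<Sum>J\<in>UNIV. of_real (c J) * pminor J A)"

definition symmetric_matrix :: "'a ^ 'n ^ 'n \<Rightarrow> bool" where
  "symmetric_matrix A \<longleftrightarrow> transpose A = A"

definition positive_definite :: "real ^ 'n::finite ^ 'n \<Rightarrow> bool" where
  "positive_definite A \<longleftrightarrow> symmetric_matrix A \<and> (\<forall>v. v \<noteq> 0 \<longrightarrow> v \<bullet> (A *v v) > 0)"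

definition Im_matrix :: "complex ^ 'n ^ 'm \<Rightarrow> real ^ 'n ^ 'm" where
  "Im_matrix Z = (\<chi> i j. Im (Z $ i $ j))"

definition PSD_stable :: "(complex ^ 'n::finite ^ 'n \<Rightarrow> complex) \<Rightarrow> bool" where
  "PSD_stable P \<longleftrightarrow> (\<forall>Z. symmetric_matrix Z \<and> positive_definite (Im_matrix Z) \<longrightarrow> P Z \<noteq> 0)"

definition homogeneous :: "(real ^ 'n::finite ^ 'n \<Rightarrow> real) \<Rightarrow> bool" where
  "homogeneous P \<longleftrightarrow> (\<exists>d::nat. \<forall>t A. symmetric_matrix A \<longrightarrow> P (t *\<^sub>R A) = t ^ d * P A)"

text \<open>For \<open>P\<close> hyperbolic with respect to \<open>I\<close>, all complex roots of \<open>P (A - t I)\<close> are real, so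
  quantifying over real \<open>t\<close> covers all roots. Here \<open>mat t\<close> is \<open>t I\<close>.\<close>

definition hyp_cone :: "(real ^ 'n::finite ^ 'n \<Rightarrow> real) \<Rightarrow> (real ^ 'n ^ 'n) set" where
  "hyp_cone P = {A. symmetric_matrix A \<and> (\<forall>t::real. P (A - mat t) = 0 \<longrightarrow> t \<ge> 0)}"

definition same_block :: "'n set set \<Rightarrow> 'n \<Rightarrow> 'n \<Rightarrow> bool" where
  "same_block \<S> i j \<longleftrightarrow> (\<exists>S\<in>\<S>. i \<in> S \<and> j \<in> S)"

definition block_space :: "'n set set \<Rightarrow> (real ^ 'n::finite ^ 'n) set" where
  "block_space \<S> = {A. symmetric_matrix A \<and> (\<forall>i j. \<not> same_block \<S> i j \<longrightarrow> A $ i $ j = 0)}"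

definition block_proj :: "'n set set \<Rightarrow> real ^ 'n::finite ^ 'n \<Rightarrow> real ^ 'n ^ 'n" where
  "block_proj \<S> A = (\<chi> i j. if same_block \<S> i j then A $ i $ j else 0)"

lemma pminor_UNIV: "pminor UNIV A = det A"
  by (simp add: pminor_def det_def)

lemma pminor_empty: "pminor {} A = 1"
  by (simp add: pminor_def)

lemma pminor_eq_det:
  fixes A :: "'a::comm_ring_1 ^ 'n::finite ^ 'n" and f :: "'k::finite \<Rightarrow> 'n"
  assumes f: "bij_betw f UNIV J"
  shows "pminor J A = det (\<chi> i j. A $ f i $ f j)"
proof -
  have inj: "inj f" and J: "J = range f"
    using f by (auto simp: bij_betw_def)
  have bij: "bij_betw (map_permutation UNIV f) {p. p permutes UNIV} {p. p permutes J}"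
  proof (rule bij_betw_byWitness[where f' = "map_permutation J (inv f)"])
    have g: "bij_betw (inv f) J UNIV"
      using bij_betw_inv_into[OF f] by simp
    show "\<forall>p\<in>{p. p permutes UNIV}. map_permutation J (inv f) (map_permutation UNIV f p) = p"
      using inj by (auto intro!: map_permutation_compose_inv[OF f])
    show "\<forall>p\<in>{p. p permutes J}. map_permutation UNIV f (map_permutation J (inv f) p) = p"
      using map_permutation_compose_inv[OF g, where g = f] J by (simp add: f_inv_into_f)
    show "map_permutation UNIV f ` {p. p permutes UNIV} \<subseteq> {p. p permutes J}"
      by (auto intro!: map_permutation_permutes[OF f])
    show "map_permutation J (inv f) ` {p. p permutes J} \<subseteq> {p. p permutes UNIV}"
      using map_permutation_permutes[OF g] by blast
  qed
  have eq: "map_permutation UNIV f p (f i) = f (p i)" for p :: "'k \<Rightarrow> 'k" and i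
    using inj by (simp add: map_permutation_apply)
  have "pminor J A = (\<Sum>p | p permutes UNIV. of_int (sign (map_permutation UNIV f p)) *
          (\<Prod>i\<in>J. A $ i $ map_permutation UNIV f p i))"
    unfolding pminor_def by (rule sum.reindex_bij_betw[OF bij, symmetric])
  also have "\<dots> = (\<Sum>p | p permutes UNIV. of_int (sign p) * (\<Prod>i\<in>UNIV. A $ f i $ f (p i)))"
  proof (rule sum.cong[OF refl], clarify)
    fix p :: "'k \<Rightarrow> 'k" assume p: "p permutes UNIV"
    have "sign (map_permutation UNIV f p) = sign p"
      using p inj by (simp add: sign_map_permutation)
    moreover have "(\<Prod>i\<in>J. A $ i $ map_permutation UNIV f p i) = (\<Prod>i\<in>UNIV. A $ f i $ f (p i))"
      using prod.reindex_bij_betw[OF f, of "\<lambda>i. A $ i $ map_permutation UNIV f p i"]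
      by (simp add: eq)
    ultimately show "of_int (sign (map_permutation UNIV f p)) *
          (\<Prod>i\<in>J. A $ i $ map_permutation UNIV f p i) =
        of_int (sign p) * (\<Prod>i\<in>UNIV. A $ f i $ f (p i))"
      by simp
  qed
  finally show ?thesis by (simp add: det_def)
qed

lemma block_proj_in_block_space:
  assumes "symmetric_matrix A"
  shows "block_proj \<S> A \<in> block_space \<S>"
  using assms
  by (auto simp: block_proj_def block_space_def symmetric_matrix_def transpose_def
        same_block_def vec_eq_iff)

lemma block_proj_orthogonal:
  assumes "B \<in> block_space \<S>"
  shows "(A - block_proj \<S> A) \<bullet> B = 0"
  using assms
  by (auto simp: block_proj_def block_space_def inner_vec_def intro!: sum.neutral)

end

theory Submission
  imports Defs "HOL-Computational_Algebra.Fundamental_Theorem_Algebra"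
begin

text \<open>Let \<open>S\<close> be a block of the partition and \<open>D\<close> the diagonal matrix with entry \<open>- 1\<close> on \<open>S\<close> and \<open>1\<close>
  elsewhere. Principal minors do not change under the conjugation \<open>A \<mapsto> D A D\<close>, so an lpm polynomial
  \<open>P\<close> and its hyperbolicity cone are invariant under it. The average of \<open>A\<close> and \<open>D A D\<close> is \<open>A\<close> with the
  entries between \<open>S\<close> and its complement set to zero, and doing this for all blocks in turn gives the
  projection onto the block matrices (\<open>cut_insert\<close>, \<open>block_proj_eq_cut\<close>). It therefore suffices that
  the hyperbolicity cone is convex (\<open>cone_combination\<close>) and that
  \<open>P ((A + B) / 2)\<^sup>2 \<ge> P A * P B\<close> on it (\<open>midpoint_log_concave\<close>): for \<open>B = D A D\<close> the right-hand side is
  \<open>(P A)\<^sup>2\<close>, and \<open>P\<close> is nonnegative on the cone.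

  Both facts belong to Garding's theory of hyperbolic polynomials, developed here in a locale. Its core
  is a statement on zeros: if \<open>A\<close> and \<open>B\<close> lie in the cone, then \<open>P\<close> has no zero with imaginary part
  \<open>a e + s A + b B\<close>, where \<open>a > 0\<close> and \<open>s, b \<ge> 0\<close> (\<open>stable_cone\<close>). It is obtained by following the
  roots of \<open>P\<close> along a moving line: they can leave the lower half-plane only through the real axis
  (\<open>upper_half_plane_path\<close>). As a consequence \<open>P (A + x B) = P B * (\<Prod>i<d. x + \<mu> i)\<close> with
  positive \<open>\<mu> i\<close> for interior points \<open>A\<close> and \<open>B\<close> of the cone (\<open>restriction_to_line\<close>), and the midpoint
  inequality is the inequality of arithmetic and geometric means applied to \<open>1\<close> and each \<open>\<mu> i\<close>.

  That the definitions meet the hypotheses of the locale is \<open>lpm_hyperbolic_polynomial\<close>; there,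
  homogeneity must be carried over from real to complex matrices (\<open>homogeneous_lpm_coeff\<close>).\<close>

section \<open>Two bounds for products\<close>

text \<open>Every linear factor \<open>t - r\<close> has modulus at least \<open>Im t\<close> when \<open>Im r \<le> 0\<close>. The bound depends on
  the polynomial only through its degree and leading coefficient, so it survives limits in a family
  where these are constant: it is a quantitative substitute for the continuity of roots.\<close>

lemma norm_poly_ge_of_no_upper_roots:
  fixes p :: "complex poly"
  assumes "\<And>t. Im t > 0 \<Longrightarrow> poly p t \<noteq> 0" and "Im t \<ge> 0"
  shows "norm (poly p t) \<ge> norm (lead_coeff p) * Im t ^ degree p"
proof -
  obtain r where r: "smult (lead_coeff p) (\<Prod>i<degree p. [:- r i, 1:]) = p"
    using complex_poly_decompose' by blast
  have val: "poly p z = lead_coeff p * (\<Prod>i<degree p. z - r i)" for z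
    by (subst r[symmetric]) (simp add: poly_prod)
  have "Im t \<le> norm (t - r i)" if "i < degree p" for i
  proof -
    have "poly p (r i) = 0"
      unfolding val using that by (auto intro!: prod_zero)
    hence "Im (r i) \<le> 0"
      using assms(1) not_le by blast
    thus ?thesis
      using abs_Im_le_cmod[of "t - r i"] by simp
  qed
  hence "(\<Prod>i<degree p. Im t) \<le> (\<Prod>i<degree p. norm (t - r i))"
    using assms(2) by (intro prod_mono) auto
  thus ?thesis
    by (simp add: val norm_mult prod_norm mult_left_mono)
qed

text \<open>The inequality of arithmetic and geometric means, \<open>(1 + \<mu>)\<^sup>2 \<ge> 4 \<mu>\<close>, factor by factor.\<close>

lemma square_prod_one_plus_ge:
  fixes d :: nat and \<mu> :: "nat \<Rightarrow> real"
  assumes "\<And>i. i < d \<Longrightarrow> \<mu> i > 0"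
  shows "4 ^ d * (\<Prod>i<d. \<mu> i) \<le> (\<Prod>i<d. 1 + \<mu> i)\<^sup>2"
proof -
  have "(\<Prod>i<d. 4 * \<mu> i) \<le> (\<Prod>i<d. (1 + \<mu> i)\<^sup>2)"
  proof (intro prod_mono conjI)
    fix i assume "i \<in> {..<d}"
    have "0 \<le> (1 - \<mu> i)\<^sup>2" by simp
    thus "4 * \<mu> i \<le> (1 + \<mu> i)\<^sup>2" by (simp add: power2_eq_square algebra_simps)
  qed (use assms in \<open>auto simp: less_imp_le\<close>)
  thus ?thesis by (simp add: prod.distrib prod_power_distrib)
qed

section \<open>Hyperbolic polynomials and their lines\<close>

text \<open>A polynomial \<open>P\<close> on the real space \<open>W\<close>, homogeneous of degree \<open>d\<close> and hyperbolic with respect to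
  \<open>e\<close>. The value \<open>F X Y\<close> stands for \<open>P (X + i Y)\<close>; the complexification of \<open>W\<close> is thereby avoided, at
  the price of writing a complex multiple as a pair of real ones: the arguments of \<open>F\<close> in the
  homogeneity assumption are the real and imaginary part of \<open>z (X + i Y)\<close>. Hyperbolicity is the
  nonvanishing of \<open>P (X + i a e)\<close> for \<open>a > 0\<close>. Polynomiality is recorded along the complex lines with
  a real direction, which is where the fundamental theorem of algebra is applied.\<close>

locale hyperbolic_polynomial =
  fixes W :: "'v::real_normed_vector set" and P :: "'v \<Rightarrow> real"
    and F :: "'v \<Rightarrow> 'v \<Rightarrow> complex" and d :: nat and e :: 'v
  assumes subspace_W: "subspace W" and e_W: "e \<in> W"
    and F_real: "X \<in> W \<Longrightarrow> F X 0 = of_real (P X)"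
    and continuous_F: "continuous_on UNIV (\<lambda>Z. F (fst Z) (snd Z))"
    and homogeneous_F: "X \<in> W \<Longrightarrow> Y \<in> W \<Longrightarrow>
      F (Re z *\<^sub>R X - Im z *\<^sub>R Y) (Re z *\<^sub>R Y + Im z *\<^sub>R X) = z ^ d * F X Y"
    and polynomial_on_lines: "X \<in> W \<Longrightarrow> Y \<in> W \<Longrightarrow> A \<in> W \<Longrightarrow>
      \<exists>p. \<forall>t. F (X + Re t *\<^sub>R A) (Y + Im t *\<^sub>R A) = poly p t"
    and hyperbolic: "X \<in> W \<Longrightarrow> a > 0 \<Longrightarrow> F X (a *\<^sub>R e) \<noteq> 0"
    and P_e_pos: "P e > 0"
begin

lemma W_intros [intro, simp]:
  "0 \<in> W" "e \<in> W" "X \<in> W \<Longrightarrow> a *\<^sub>R X \<in> W" "X \<in> W \<Longrightarrow> Y \<in> W \<Longrightarrow> X + Y \<in> W"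
  "X \<in> W \<Longrightarrow> Y \<in> W \<Longrightarrow> X - Y \<in> W" "X \<in> W \<Longrightarrow> - X \<in> W"
  using subspace_W e_W
  by (auto simp: subspace_0 subspace_scale subspace_add subspace_diff subspace_neg)

lemma continuous_on_F [continuous_intros]:
  assumes "continuous_on S f" "continuous_on S g"
  shows "continuous_on S (\<lambda>x. F (f x) (g x))"
  using continuous_on_compose2[OF continuous_F continuous_on_Pair[OF assms]] by simp

lemma homogeneous_F_real:
  assumes "X \<in> W" "Y \<in> W"
  shows "F (a *\<^sub>R X) (a *\<^sub>R Y) = of_real a ^ d * F X Y"
  using homogeneous_F[OF assms, of "of_real a"] by simp

lemma homogeneous_P: "X \<in> W \<Longrightarrow> P (a *\<^sub>R X) = a ^ d * P X"
  using homogeneous_F_real[of X 0 a] F_real[of X] F_real[of "a *\<^sub>R X"]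
  by (simp flip: of_real_power of_real_mult)

lemma F_imaginary: "Y \<in> W \<Longrightarrow> F 0 Y = \<i> ^ d * of_real (P Y)"
  using homogeneous_F[of Y 0 \<i>] F_real[of Y] by simp

text \<open>The reversed polynomial \<open>s \<mapsto> P (s (X + i Y) + A)\<close> takes the value \<open>P A\<close> at \<open>s = 0\<close>. As this is
  nonzero, the degree along the line is exactly \<open>d\<close>, and the leading coefficient is \<open>P A\<close>, whatever the
  base point of the line.\<close>

lemma line_polynomial:
  assumes W: "X \<in> W" "Y \<in> W" "A \<in> W" and A: "P A \<noteq> 0"
  obtains p where "\<And>t. F (X + Re t *\<^sub>R A) (Y + Im t *\<^sub>R A) = poly p t"
    and "degree p = d" and "lead_coeff p = of_real (P A)"
proof -
  obtain p where p: "\<And>t. F (X + Re t *\<^sub>R A) (Y + Im t *\<^sub>R A) = poly p t"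
    using polynomial_on_lines[OF W] by blast
  let ?q = "\<lambda>s. F (s *\<^sub>R X + A) (s *\<^sub>R Y)"
  have eq: "of_real s ^ (degree p - d) * ?q s
      = of_real s ^ (d - degree p) * poly (reflect_poly p) (of_real s)" if "s \<noteq> 0" for s
  proof -
    have "of_real s ^ d * poly p (of_real (inverse s)) = ?q s"
      using homogeneous_F_real[of "X + inverse s *\<^sub>R A" Y s] that W
        p[of "of_real (inverse s)", unfolded Re_complex_of_real Im_complex_of_real]
      by (simp add: scaleR_add_right)
    moreover have "poly (reflect_poly p) (of_real s)
        = of_real s ^ degree p * poly p (of_real (inverse s))"
      using that by (simp add: poly_reflect_poly_nz of_real_inverse)
    moreover have "degree p - d + d = d - degree p + degree p"
      by simp
    ultimately show ?thesis
      by (metis mult.assoc power_add)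
  qed
  \<comment> \<open>Both sides are continuous in \<open>s\<close>, so they also agree at \<open>s = 0\<close>.\<close>
  have "0 ^ (degree p - d) * ?q 0 = 0 ^ (d - degree p) * poly (reflect_poly p) 0"
  proof (rule tendsto_unique[OF _ _ Lim_transform_eventually])
    show "at (0::real) \<noteq> bot" by simp
    have "continuous_on UNIV (\<lambda>s. of_real s ^ (degree p - d) * ?q s)"
      by (intro continuous_intros)
    hence "((\<lambda>s. of_real s ^ (degree p - d) * ?q s)
        \<longlongrightarrow> of_real 0 ^ (degree p - d) * ?q 0) (at 0)"
      unfolding continuous_on_def by blast
    thus "((\<lambda>s. of_real s ^ (degree p - d) * ?q s)
        \<longlongrightarrow> 0 ^ (degree p - d) * ?q 0) (at (0::real))"
      by simp
    have "continuous_on UNIV (\<lambda>s::real. of_real s ^ (d - degree p) * poly (reflect_poly p) (of_real s))"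
      by (intro continuous_intros)
    hence "((\<lambda>s::real. of_real s ^ (d - degree p) * poly (reflect_poly p) (of_real s))
        \<longlongrightarrow> of_real 0 ^ (d - degree p) * poly (reflect_poly p) (of_real 0)) (at 0)"
      unfolding continuous_on_def by blast
    thus "((\<lambda>s. of_real s ^ (d - degree p) * poly (reflect_poly p) (of_real s))
        \<longlongrightarrow> 0 ^ (d - degree p) * poly (reflect_poly p) 0) (at (0::real))"
      by simp
    show "\<forall>\<^sub>F s in at 0. of_real s ^ (d - degree p) * poly (reflect_poly p) (of_real s)
        = of_real s ^ (degree p - d) * ?q s"
      using eq by (auto simp: eventually_at_filter)
  qed
  hence lim: "0 ^ (degree p - d) * of_real (P A) = 0 ^ (d - degree p) * lead_coeff p"
    using F_real W by simp
  have "degree p = d"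
  proof (rule linorder_cases[of "degree p" d])
    assume "degree p < d"
    thus ?thesis using lim A by (simp add: zero_power)
  next
    assume *: "d < degree p"
    hence "lead_coeff p = 0" using lim by (simp add: zero_power)
    thus ?thesis using * by simp
  qed
  thus ?thesis using that[OF p] lim by simp
qed

text \<open>The continuity argument behind all the stability results below. Move the base point of a line with
  direction \<open>A\<close> from \<open>X + i Y\<close> to \<open>X + X' + i (Y + Y')\<close>. If the restriction of \<open>P\<close> to the line starts
  without roots in the closed upper half-plane, and no root ever lies on the real axis, then no root
  can enter, neither through the boundary nor from infinity, because the degree is constant.

  In terms of the path parameter \<open>\<tau>\<close>: the set \<open>G\<close> of good parameters is closed by the root-free lower
  bound for \<open>\<bar>P\<bar>\<close>, the set \<open>B\<close> of bad ones is closed as the projection of a compact set, and the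
  interval is connected.\<close>

lemma upper_half_plane_path:
  assumes W: "X \<in> W" "Y \<in> W" "X' \<in> W" "Y' \<in> W" "A \<in> W" and A: "P A \<noteq> 0"
    and start: "\<And>t. Im t \<ge> 0 \<Longrightarrow> F (X + Re t *\<^sub>R A) (Y + Im t *\<^sub>R A) \<noteq> 0"
    and boundary: "\<And>\<tau> x. 0 \<le> \<tau> \<Longrightarrow> \<tau> \<le> 1 \<Longrightarrow> F (X + \<tau> *\<^sub>R X' + x *\<^sub>R A) (Y + \<tau> *\<^sub>R Y') \<noteq> 0"
    and t: "Im t \<ge> 0"
  shows "F (X + X' + Re t *\<^sub>R A) (Y + Y' + Im t *\<^sub>R A) \<noteq> 0"
proof -
  define q where "q \<tau> t = F (X + \<tau> *\<^sub>R X' + Re t *\<^sub>R A) (Y + \<tau> *\<^sub>R Y' + Im t *\<^sub>R A)" for \<tau> t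
  define G where "G = {\<tau>\<in>{0..1}. \<forall>t. Im t \<ge> 0 \<longrightarrow> q \<tau> t \<noteq> 0}"
  define B where "B = {\<tau>\<in>{0..1}. \<exists>t. Im t \<ge> 0 \<and> q \<tau> t = 0}"
  have real: "q \<tau> t \<noteq> 0" if "\<tau> \<in> {0..1}" "Im t = 0" for \<tau> t
    using boundary[of \<tau> "Re t"] that by (simp add: q_def)
  \<comment> \<open>For positive \<open>Im t\<close> the lower bound says that \<open>t\<close> is not a root; on the real axis it is void, but
    there are no real roots anyway. Unlike nonvanishing, it is a closed condition on \<open>\<tau>\<close>.\<close>
  have "G = {0..1} \<inter> (\<Inter>t\<in>{t. Im t \<ge> 0}. {\<tau>. \<bar>P A\<bar> * Im t ^ d \<le> norm (q \<tau> t)})"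
  proof (intro equalityI subsetI)
    fix \<tau> assume \<tau>: "\<tau> \<in> G"
    obtain p where "\<And>t. q \<tau> t = poly p t" "degree p = d" "lead_coeff p = of_real (P A)"
      unfolding q_def by (rule line_polynomial[of "X + \<tau> *\<^sub>R X'" "Y + \<tau> *\<^sub>R Y'" A]) (use W A in auto)
    thus "\<tau> \<in> {0..1} \<inter> (\<Inter>t\<in>{t. Im t \<ge> 0}. {\<tau>. \<bar>P A\<bar> * Im t ^ d \<le> norm (q \<tau> t)})"
      using norm_poly_ge_of_no_upper_roots[of p] \<tau> by (force simp: G_def)
  next
    fix \<tau> assume \<tau>: "\<tau> \<in> {0..1} \<inter> (\<Inter>t\<in>{t. Im t \<ge> 0}. {\<tau>. \<bar>P A\<bar> * Im t ^ d \<le> norm (q \<tau> t)})"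
    have "q \<tau> t \<noteq> 0" if "Im t > 0" for t
    proof -
      have "\<bar>P A\<bar> * Im t ^ d > 0" using that A by simp
      also have "\<dots> \<le> norm (q \<tau> t)" using that \<tau> by auto
      finally show ?thesis by auto
    qed
    thus "\<tau> \<in> G"
      using real \<tau> by (force simp: G_def le_less)
  qed
  moreover have "closed {\<tau>. \<bar>P A\<bar> * Im t ^ d \<le> norm (q \<tau> t)}" for t
    unfolding q_def by (intro closed_Collect_le continuous_intros)
  ultimately have G: "closed G"
    by auto
  have B: "closed B"
  proof -
    \<comment> \<open>Roots could a priori escape to infinity. In homogeneous coordinates \<open>(s, t)\<close>, normalised by
      \<open>s + \<bar>t\<bar> = 1\<close>, the root set is compact, and the point at infinity \<open>s = 0\<close> is not a root since
      \<open>P A \<noteq> 0\<close>.\<close>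
    define K :: "(real \<times> real \<times> complex) set" where "K = {0..1} \<times> {0..1} \<times> cball 0 1"
    define N where "N = {z::real \<times> real \<times> complex. Im (snd (snd z)) \<ge> 0 \<and>
      fst (snd z) + norm (snd (snd z)) = 1 \<and>
      F (fst (snd z) *\<^sub>R (X + fst z *\<^sub>R X') + Re (snd (snd z)) *\<^sub>R A)
        (fst (snd z) *\<^sub>R (Y + fst z *\<^sub>R Y') + Im (snd (snd z)) *\<^sub>R A) = 0}"
    define Z where "Z = K \<inter> N"
    have "closed N"
      unfolding N_def
      by (intro closed_Collect_conj closed_Collect_le closed_Collect_eq continuous_intros)
    hence "compact Z"
      unfolding Z_def K_def by (intro compact_Int_closed compact_Times compact_Icc compact_cball)
    hence "closed (fst ` Z)"
      by (intro compact_imp_closed compact_continuous_image continuous_intros)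
    moreover have "B = fst ` Z"
    proof (intro equalityI subsetI)
      fix \<tau> assume "\<tau> \<in> B"
      then obtain t where t: "\<tau> \<in> {0..1}" "Im t \<ge> 0" "q \<tau> t = 0"
        by (auto simp: B_def)
      define s where "s = inverse (1 + norm t)"
      have s: "0 < s" "s \<le> 1" "s * norm t \<le> 1" "s + s * norm t = 1"
        using norm_ge_zero[of t] by (auto simp: s_def field_simps add_pos_nonneg add_nonneg_eq_0_iff
            simp flip: add_divide_distrib)
      have "F (s *\<^sub>R (X + \<tau> *\<^sub>R X' + Re t *\<^sub>R A)) (s *\<^sub>R (Y + \<tau> *\<^sub>R Y' + Im t *\<^sub>R A)) = 0"
        using t W by (subst homogeneous_F_real) (auto simp: q_def)
      hence "(\<tau>, s, s *\<^sub>R t) \<in> Z"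
        using t s by (auto simp: Z_def K_def N_def algebra_simps)
      thus "\<tau> \<in> fst ` Z" by force
    next
      fix \<tau> assume "\<tau> \<in> fst ` Z"
      then obtain s t where st: "\<tau> \<in> {0..1}" "s \<ge> 0" "Im t \<ge> 0" "s + norm t = 1"
        and zero: "F (s *\<^sub>R (X + \<tau> *\<^sub>R X') + Re t *\<^sub>R A) (s *\<^sub>R (Y + \<tau> *\<^sub>R Y') + Im t *\<^sub>R A) = 0"
        by (force simp: Z_def K_def N_def)
      have "s \<noteq> 0"
      proof
        assume "s = 0"
        hence "t ^ d * F A 0 = 0" and "t \<noteq> 0"
          using zero homogeneous_F[of A 0 t] W st by auto
        thus False using A F_real W by simp
      qed
      moreover have "Re (t / of_real s) = inverse s * Re t" "Im (t / of_real s) = inverse s * Im t"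
        unfolding Re_divide_of_real Im_divide_of_real by (simp_all add: field_simps)
      ultimately have "F (X + \<tau> *\<^sub>R X' + Re (t / of_real s) *\<^sub>R A) (Y + \<tau> *\<^sub>R Y' + Im (t / of_real s) *\<^sub>R A) = 0"
        using zero homogeneous_F_real[of "s *\<^sub>R (X + \<tau> *\<^sub>R X') + Re t *\<^sub>R A"
          "s *\<^sub>R (Y + \<tau> *\<^sub>R Y') + Im t *\<^sub>R A" "inverse s"] W
        by (simp add: scaleR_add_right flip: mult.assoc)
      thus "\<tau> \<in> B"
        using st \<open>s \<noteq> 0\<close> by (auto simp: B_def q_def intro!: exI[of _ "t / of_real s"])
    qed
    ultimately show ?thesis by simp
  qed
  have "0 \<in> G"
    using start by (simp add: G_def q_def)
  moreover have "{0..1} \<subseteq> G \<union> B" "G \<inter> B = {}"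
    by (auto simp: G_def B_def)
  moreover have "B \<subseteq> {0..1}" by (auto simp: B_def)
  ultimately have "B = {}"
    using connected_closedD[OF connected_Icc[of "0::real" 1], of G B] G B by fastforce
  thus ?thesis
    using t by (auto simp: B_def q_def)
qed

section \<open>The hyperbolicity cone\<close>

text \<open>The closed cone: \<open>P (A - t e)\<close> has no negative root \<open>t = - s\<close>. Its interior consists of the members
  with \<open>P A \<noteq> 0\<close>, and shifting by a positive multiple of \<open>e\<close> leads into the interior.\<close>

definition hyperbolicity_cone :: "'v set" where
  "hyperbolicity_cone = {A \<in> W. \<forall>s>0. P (A + s *\<^sub>R e) \<noteq> 0}"

lemma cone_W: "A \<in> hyperbolicity_cone \<Longrightarrow> A \<in> W"
  by (simp add: hyperbolicity_cone_def)

lemma shift_nonzero: "A \<in> hyperbolicity_cone \<Longrightarrow> s > 0 \<Longrightarrow> P (A + s *\<^sub>R e) \<noteq> 0"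
  by (simp add: hyperbolicity_cone_def)

lemma shift_in_cone: "A \<in> hyperbolicity_cone \<Longrightarrow> s \<ge> 0 \<Longrightarrow> A + s *\<^sub>R e \<in> hyperbolicity_cone"
  by (simp add: hyperbolicity_cone_def add.assoc flip: scaleR_add_left)

lemma zero_in_cone: "0 \<in> hyperbolicity_cone"
  using P_e_pos by (simp add: hyperbolicity_cone_def homogeneous_P)

lemma hyperbolic_nonzero:
  assumes "X \<in> W" "a \<noteq> 0"
  shows "F X (a *\<^sub>R e) \<noteq> 0"
proof (cases "a > 0")
  case False
  hence "F (- X) ((- a) *\<^sub>R e) \<noteq> 0"
    using assms by (intro hyperbolic) auto
  thus ?thesis
    using homogeneous_F_real[of X "a *\<^sub>R e" "-1"] assms by auto
qed (use assms hyperbolic in auto)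

text \<open>Inside the plane spanned by \<open>e\<close> and \<open>A\<close>: dividing \<open>i a e + t A\<close> by \<open>t\<close> gives \<open>A + w e\<close> with
  \<open>w = i a / t\<close>. A nonreal \<open>w\<close> is excluded by hyperbolicity; a real \<open>w\<close> is nonnegative because
  \<open>Im t \<ge> 0\<close>, and is excluded by membership in the cone.\<close>

lemma cone_plane_nonzero:
  assumes "A \<in> hyperbolicity_cone" "P A \<noteq> 0" "a > 0" "Im t \<ge> 0"
  shows "F (Re t *\<^sub>R A) (a *\<^sub>R e + Im t *\<^sub>R A) \<noteq> 0"
proof (cases "t = 0")
  case False
  have A: "A \<in> W" using assms cone_W by blast
  define w where "w = \<i> * of_real a / t"
  have "t * w = \<i> * of_real a"
    using False by (simp add: w_def)
  hence w: "Re t * Re w - Im t * Im w = 0" "Re t * Im w + Im t * Re w = a"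
    by (simp_all add: complex_eq_iff)
  have "F (A + Re w *\<^sub>R e) (Im w *\<^sub>R e) \<noteq> 0"
  proof (cases "Im w = 0")
    case True
    have "Re w = a * Im t / (cmod t)\<^sup>2"
      by (simp add: w_def Re_divide cmod_power2)
    hence "Re w \<ge> 0" using assms by simp
    hence "P (A + Re w *\<^sub>R e) \<noteq> 0"
      using assms by (cases "Re w = 0") (auto simp: hyperbolicity_cone_def)
    thus ?thesis
      using True A F_real by simp
  qed (use A hyperbolic_nonzero in auto)
  moreover have "Re t *\<^sub>R (A + Re w *\<^sub>R e) - Im t *\<^sub>R (Im w *\<^sub>R e)
      = Re t *\<^sub>R A + (Re t * Re w - Im t * Im w) *\<^sub>R e"
    by (simp add: algebra_simps)
  moreover have "Re t *\<^sub>R (Im w *\<^sub>R e) + Im t *\<^sub>R (A + Re w *\<^sub>R e)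
      = (Re t * Im w + Im t * Re w) *\<^sub>R e + Im t *\<^sub>R A"
    by (simp add: algebra_simps)
  ultimately show ?thesis
    using homogeneous_F[of "A + Re w *\<^sub>R e" "Im w *\<^sub>R e" t] A False by (simp add: w)
qed (use assms hyperbolic[of 0] in auto)

text \<open>Garding's argument: the path runs from \<open>i a e\<close> to \<open>X + i a e\<close>. The positive multiple of \<open>i e\<close>
  keeps the roots off the real axis by hyperbolicity. The value \<open>t = i b\<close> gives the claim.\<close>

lemma stable_direction:
  assumes "X \<in> W" "A \<in> hyperbolicity_cone" "P A \<noteq> 0" "a > 0" "b \<ge> 0"
  shows "F X (a *\<^sub>R e + b *\<^sub>R A) \<noteq> 0"
proof -
  have "F (0 + X + Re (\<i> * b) *\<^sub>R A) (a *\<^sub>R e + 0 + Im (\<i> * b) *\<^sub>R A) \<noteq> 0"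
    using assms cone_W[of A] cone_plane_nonzero[of A a] hyperbolic
    by (intro upper_half_plane_path) auto
  thus ?thesis by simp
qed

text \<open>The same argument once more, now with the path from \<open>X + i a e\<close> to \<open>X + i (a e + s A)\<close> and lines
  of direction \<open>B\<close>. The one-direction result for \<open>B\<close> gives the start of the path, the one for \<open>A\<close>
  clears the real axis. This is what makes the cone convex.\<close>

lemma stable_two_directions:
  assumes "X \<in> W" "A \<in> hyperbolicity_cone" "P A \<noteq> 0"
    and "B \<in> hyperbolicity_cone" "P B \<noteq> 0" "a > 0" "s \<ge> 0" "b \<ge> 0"
  shows "F X (a *\<^sub>R e + s *\<^sub>R A + b *\<^sub>R B) \<noteq> 0"
proof -
  have "F (X + 0 + Re (\<i> * b) *\<^sub>R B) (a *\<^sub>R e + s *\<^sub>R A + Im (\<i> * b) *\<^sub>R B) \<noteq> 0"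
    using assms cone_W[of A] cone_W[of B] stable_direction[of _ B a] stable_direction[of _ A a]
    by (intro upper_half_plane_path) auto
  thus ?thesis by simp
qed

text \<open>On the boundary of the cone, part of \<open>a e\<close> is spent on moving \<open>A\<close> and \<open>B\<close> into the interior. With
  \<open>\<delta> = a / (1 + s + b)\<close> exactly the amount \<open>\<delta> e\<close> is left over.\<close>

lemma stable_cone:
  assumes "X \<in> W" "A \<in> hyperbolicity_cone" "B \<in> hyperbolicity_cone" "a > 0" "s \<ge> 0" "b \<ge> 0"
  shows "F X (a *\<^sub>R e + s *\<^sub>R A + b *\<^sub>R B) \<noteq> 0"
proof -
  define \<delta> where "\<delta> = a / (1 + s + b)"
  have \<delta>: "\<delta> > 0" "a - (s + b) * \<delta> = \<delta>"
    using assms by (auto simp: \<delta>_def field_simps)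
  have "F X (\<delta> *\<^sub>R e + s *\<^sub>R (A + \<delta> *\<^sub>R e) + b *\<^sub>R (B + \<delta> *\<^sub>R e)) \<noteq> 0"
    using assms \<delta> by (intro stable_two_directions shift_in_cone shift_nonzero) auto
  moreover have "\<delta> *\<^sub>R e + s *\<^sub>R (A + \<delta> *\<^sub>R e) + b *\<^sub>R (B + \<delta> *\<^sub>R e)
      = (\<delta> + (s + b) * \<delta>) *\<^sub>R e + s *\<^sub>R A + b *\<^sub>R B"
    by (simp add: algebra_simps)
  ultimately show ?thesis using \<delta>(2) by (simp add: algebra_simps)
qed

lemma cone_comb_nonzero:
  assumes "A \<in> hyperbolicity_cone" "B \<in> hyperbolicity_cone" "a > 0" "s \<ge> 0" "b \<ge> 0"
  shows "P (a *\<^sub>R e + s *\<^sub>R A + b *\<^sub>R B) \<noteq> 0"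
  using stable_cone[of 0 A B a s b] assms F_imaginary cone_W by auto

lemma cone_combination:
  assumes "A \<in> hyperbolicity_cone" "B \<in> hyperbolicity_cone" "a \<ge> 0" "b \<ge> 0"
  shows "a *\<^sub>R A + b *\<^sub>R B \<in> hyperbolicity_cone"
proof -
  have "P (a *\<^sub>R A + b *\<^sub>R B + s *\<^sub>R e) \<noteq> 0" if "s > 0" for s
    using cone_comb_nonzero[OF assms(1,2) that assms(3,4)] by (simp add: ac_simps)
  thus ?thesis
    using cone_W[OF assms(1)] cone_W[OF assms(2)] by (simp add: hyperbolicity_cone_def)
qed

section \<open>Log-concavity on the cone\<close>

text \<open>Between two interior points the roots along a line are real, since a nonreal root would
  give, after multiplication by \<open>- 1\<close> if necessary, a zero of \<open>P\<close> whose imaginary part is a positive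
  multiple of \<open>B'\<close>. They are negative, since the cone is convex. The roots are written \<open>- \<mu> i\<close>.\<close>

lemma restriction_to_line:
  assumes "A \<in> hyperbolicity_cone" "B \<in> hyperbolicity_cone" "\<alpha> > 0" "\<beta> > 0"
  defines "A' \<equiv> A + \<alpha> *\<^sub>R e" and "B' \<equiv> B + \<beta> *\<^sub>R e"
  obtains \<mu> where "\<And>i. i < d \<Longrightarrow> \<mu> i > 0"
    and "\<And>x. P (A' + x *\<^sub>R B') = P B' * (\<Prod>i<d. x + \<mu> i)"
proof -
  have W: "A \<in> W" "B \<in> W" "A' \<in> W" "B' \<in> W"
    using assms cone_W by auto
  have B': "P B' \<noteq> 0"
    using assms shift_nonzero by blast
  obtain p where p: "\<And>t. F (A' + Re t *\<^sub>R B') (0 + Im t *\<^sub>R B') = poly p t"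
      "degree p = d" "lead_coeff p = of_real (P B')"
    by (rule line_polynomial[of A' 0 B']) (use W B' in auto)
  obtain r where r: "smult (lead_coeff p) (\<Prod>i<degree p. [:- r i, 1:]) = p"
    using complex_poly_decompose' by blast
  have val: "poly p z = of_real (P B') * (\<Prod>i<d. z - r i)" for z
    by (subst r[symmetric]) (simp add: poly_prod flip: p(2,3))
  have upper: "F X (y *\<^sub>R B') \<noteq> 0" if "X \<in> W" "y > 0" for X y
    using stable_cone[of X A B "y * \<beta>" 0 y] that assms by (simp add: B'_def algebra_simps)
  have root: "Im (r i) = 0 \<and> Re (r i) < 0" if "i < d" for i
  proof -
    have "poly p (r i) = 0"
      unfolding val using that by (auto intro!: prod_zero)
    hence zero: "F (A' + Re (r i) *\<^sub>R B') (Im (r i) *\<^sub>R B') = 0"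
      by (simp flip: p(1))
    hence "\<not> Im (r i) > 0"
      using upper W by auto
    moreover have "\<not> Im (r i) < 0"
    proof
      assume "Im (r i) < 0"
      hence "F (- (A' + Re (r i) *\<^sub>R B')) ((- Im (r i)) *\<^sub>R B') \<noteq> 0"
        using W by (intro upper) auto
      thus False
        using zero homogeneous_F_real[of "A' + Re (r i) *\<^sub>R B'" "Im (r i) *\<^sub>R B'" "-1"] W
        by (simp del: minus_add_distrib)
    qed
    ultimately have im: "Im (r i) = 0" by simp
    have "\<not> Re (r i) \<ge> 0"
    proof
      assume "Re (r i) \<ge> 0"
      hence "P ((\<alpha> + Re (r i) * \<beta>) *\<^sub>R e + 1 *\<^sub>R A + Re (r i) *\<^sub>R B) \<noteq> 0"
        using assms by (intro cone_comb_nonzero) (auto simp: add_pos_nonneg)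
      moreover have "(\<alpha> + Re (r i) * \<beta>) *\<^sub>R e + 1 *\<^sub>R A + Re (r i) *\<^sub>R B = A' + Re (r i) *\<^sub>R B'"
        by (simp add: A'_def B'_def algebra_simps)
      ultimately show False
        using zero im F_real W by simp
    qed
    thus ?thesis using im by simp
  qed
  show ?thesis
  proof (rule that[of "\<lambda>i. - Re (r i)"])
    fix x :: real
    have "complex_of_real (P (A' + x *\<^sub>R B')) = of_real (P B') * (\<Prod>i<d. of_real x - r i)"
      using p(1)[of "of_real x"] F_real W by (simp add: val)
    also have "(\<Prod>i<d. of_real x - r i) = (\<Prod>i<d. of_real (x + - Re (r i)))"
      using root by (intro prod.cong) (auto simp: complex_eq_iff)
    finally show "P (A' + x *\<^sub>R B') = P B' * (\<Prod>i<d. x + - Re (r i))"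
      by (simp only: flip: of_real_prod of_real_mult) (simp only: of_real_eq_iff)
  qed (use root in auto)
qed

text \<open>Take the line from \<open>A + \<alpha> e\<close> in direction \<open>e\<close>: its value at \<open>0\<close> is \<open>P e\<close> times the product of the
  positive \<open>\<mu> i\<close>. The direction \<open>e\<close> is presented as the cone point \<open>0\<close> shifted by \<open>e\<close>.\<close>

lemma P_shift_pos:
  assumes "A \<in> hyperbolicity_cone" "\<alpha> > 0"
  shows "P (A + \<alpha> *\<^sub>R e) > 0"
proof -
  obtain \<mu> where "\<And>i. i < d \<Longrightarrow> \<mu> i > 0"
    "\<And>x. P (A + \<alpha> *\<^sub>R e + x *\<^sub>R (0 + 1 *\<^sub>R e)) = P (0 + 1 *\<^sub>R e) * (\<Prod>i<d. x + \<mu> i)"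
    by (rule restriction_to_line[OF assms(1) zero_in_cone assms(2) zero_less_one]) (rule that)
  from this(1) this(2)[of 0] show ?thesis
    using P_e_pos by (auto intro!: mult_pos_pos prod_pos)
qed

lemma P_shift_tendsto:
  assumes "A \<in> W"
  shows "((\<lambda>\<alpha>. P (A + \<alpha> *\<^sub>R e)) \<longlongrightarrow> P A) (at_right 0)"
proof -
  have "continuous_on UNIV (\<lambda>\<alpha>. F (A + \<alpha> *\<^sub>R e) 0)"
    by (intro continuous_intros)
  hence "((\<lambda>\<alpha>. F (A + \<alpha> *\<^sub>R e) 0) \<longlongrightarrow> F (A + 0 *\<^sub>R e) 0) (at 0)"
    unfolding continuous_on_def by blast
  hence "((\<lambda>\<alpha>. complex_of_real (P (A + \<alpha> *\<^sub>R e))) \<longlongrightarrow> of_real (P A)) (at 0)"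
    using assms F_real by simp
  thus ?thesis
    by (intro filterlim_at_split[THEN iffD1, THEN conjunct2]) (simp only: tendsto_of_real_iff)
qed

lemma P_nonneg:
  assumes "A \<in> hyperbolicity_cone"
  shows "P A \<ge> 0"
proof (rule tendsto_lowerbound[OF P_shift_tendsto])
  show "\<forall>\<^sub>F \<alpha> in at_right 0. 0 \<le> P (A + \<alpha> *\<^sub>R e)"
    using P_shift_pos[OF assms] by (auto simp: eventually_at_filter less_imp_le)
qed (use assms cone_W in auto)

text \<open>A midpoint form of Garding's inequality. In the interior, factor \<open>P\<close> along the line through \<open>A\<close> in
  direction \<open>B\<close>. With \<open>\<mu> i\<close> the negated roots, \<open>P A / P B\<close> is the product of the \<open>\<mu> i\<close> and
  \<open>P (A + B) / P B\<close> the product of the \<open>1 + \<mu> i\<close>, so the arithmetic-geometric mean inequality compares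
  them. The general case follows by shifting both points into the interior and letting the shift
  tend to zero.\<close>

lemma midpoint_log_concave:
  assumes A: "A \<in> hyperbolicity_cone" and B: "B \<in> hyperbolicity_cone"
  shows "P A * P B \<le> (P ((1/2) *\<^sub>R (A + B)))\<^sup>2"
proof -
  have W: "A \<in> W" "B \<in> W" using assms cone_W by auto
  have shifted: "4 ^ d * (P (A + \<alpha> *\<^sub>R e) * P (B + \<alpha> *\<^sub>R e)) \<le> (P (A + B + (2 * \<alpha>) *\<^sub>R e))\<^sup>2"
    if "\<alpha> > 0" for \<alpha>
  proof -
    obtain \<mu> where \<mu>: "\<And>i. i < d \<Longrightarrow> \<mu> i > 0"
      "\<And>x. P (A + \<alpha> *\<^sub>R e + x *\<^sub>R (B + \<alpha> *\<^sub>R e)) = P (B + \<alpha> *\<^sub>R e) * (\<Prod>i<d. x + \<mu> i)"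
      by (rule restriction_to_line[OF A B \<open>\<alpha> > 0\<close> \<open>\<alpha> > 0\<close>]) (rule that)
    have "P (A + B + (2 * \<alpha>) *\<^sub>R e) = P (B + \<alpha> *\<^sub>R e) * (\<Prod>i<d. 1 + \<mu> i)"
      using \<mu>(2)[of 1] by (simp add: algebra_simps scaleR_2 flip: scaleR_scaleR)
    moreover have "P (A + \<alpha> *\<^sub>R e) = P (B + \<alpha> *\<^sub>R e) * (\<Prod>i<d. \<mu> i)"
      using \<mu>(2)[of 0] by simp
    ultimately show ?thesis
      using mult_left_mono[OF square_prod_one_plus_ge[of d \<mu>, OF \<mu>(1)], of "(P (B + \<alpha> *\<^sub>R e))\<^sup>2"]
      by (simp add: power_mult_distrib power2_eq_square mult_ac)
  qed
  have "4 ^ d * (P A * P B) \<le> (P (A + B))\<^sup>2"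
  proof (rule tendsto_le)
    show "((\<lambda>\<alpha>. 4 ^ d * (P (A + \<alpha> *\<^sub>R e) * P (B + \<alpha> *\<^sub>R e))) \<longlongrightarrow> 4 ^ d * (P A * P B)) (at_right 0)"
      by (intro tendsto_intros P_shift_tendsto W)
    have "filterlim (\<lambda>\<alpha>::real. 2 * \<alpha>) (at_right 0) (at_right 0)"
      by (rule filterlim_times_pos) (auto intro: filterlim_ident)
    from filterlim_compose[OF P_shift_tendsto this, of "A + B"]
    show "((\<lambda>\<alpha>. (P (A + B + (2 * \<alpha>) *\<^sub>R e))\<^sup>2) \<longlongrightarrow> (P (A + B))\<^sup>2) (at_right 0)"
      using W by (intro tendsto_intros) auto
    show "\<forall>\<^sub>F \<alpha> in at_right 0. 4 ^ d * (P (A + \<alpha> *\<^sub>R e) * P (B + \<alpha> *\<^sub>R e))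
        \<le> (P (A + B + (2 * \<alpha>) *\<^sub>R e))\<^sup>2"
      using shifted by (auto simp: eventually_at_filter)
  qed simp
  moreover have "P (A + B) = 2 ^ d * P ((1/2) *\<^sub>R (A + B))"
    using homogeneous_P[of "(1/2) *\<^sub>R (A + B)" 2] W by simp
  moreover have "(2 ^ d)\<^sup>2 = (4::real) ^ d"
    by (simp add: power2_eq_square flip: power_mult_distrib)
  ultimately show ?thesis
    by (simp add: power_mult_distrib)
qed

end

section \<open>Linear principal minor polynomials are hyperbolic\<close>

definition diagonal_matrix :: "('n \<Rightarrow> 'a::zero) \<Rightarrow> 'a ^ 'n ^ 'n" where
  "diagonal_matrix D = (\<chi> i j. if i = j then D i else 0)"

definition complex_matrix :: "real ^ 'n ^ 'n \<Rightarrow> real ^ 'n ^ 'n \<Rightarrow> complex ^ 'n ^ 'n" where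
  "complex_matrix X Y = (\<chi> i j. Complex (X $ i $ j) (Y $ i $ j))"

lemma pminor_scale:
  "pminor J (\<chi> i j. z * A $ i $ j) = z ^ card J * pminor J A"
  by (simp add: pminor_def prod.distrib sum_distrib_left mult_ac)

lemma pminor_diagonal:
  fixes D :: "'n::finite \<Rightarrow> 'a::comm_ring_1"
  shows "pminor J (diagonal_matrix D) = (\<Prod>i\<in>J. D i)"
proof -
  have "(\<Prod>i\<in>J. diagonal_matrix D $ i $ p i) = (if p = id then \<Prod>i\<in>J. D i else 0)"
    if "p permutes J" for p
  proof (cases "p = id")
    case False
    then obtain i where "p i \<noteq> i" by (auto simp: fun_eq_iff)
    moreover from this have "i \<in> J" using that by (metis permutes_not_in)
    ultimately show ?thesis
      using False by (auto simp: diagonal_matrix_def intro!: prod_zero bexI[of _ i])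
  qed (simp add: diagonal_matrix_def)
  hence "pminor J (diagonal_matrix D)
      = (\<Sum>p | p permutes J. of_int (sign p) * (if p = id then \<Prod>i\<in>J. D i else 0))"
    unfolding pminor_def by (intro sum.cong) auto
  also have "\<dots> = (\<Sum>p | p permutes J. if p = id then \<Prod>i\<in>J. D i else 0)"
    by (intro sum.cong) auto
  also have "\<dots> = (\<Prod>i\<in>J. D i)"
    by (subst sum.delta) (auto simp: finite_permutations permutes_id)
  finally show ?thesis .
qed

text \<open>Homogeneity on real matrices becomes a statement about coefficients, which then passes to complex
  matrices. Induct on \<open>J\<close> by cardinality and evaluate at the diagonal 0-1 matrix \<open>E 1\<close> supported on \<open>J\<close>
  and at its double \<open>E 2\<close>: every proper subset of \<open>J\<close> already satisfies the claim and contributes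
  nothing to \<open>P (E 2) - 2 ^ d P (E 1)\<close>, so the term of \<open>J\<close> vanishes.\<close>

lemma homogeneous_lpm_coeff:
  fixes c :: "'n::finite set \<Rightarrow> real"
  assumes hom: "\<And>t A. symmetric_matrix A \<Longrightarrow> lpm c (t *\<^sub>R A :: real ^ 'n ^ 'n) = t ^ d * lpm c A"
  shows "c J = 0 \<or> card J = d"
proof (induction "card J" arbitrary: J rule: less_induct)
  case less
  define E where "E t = diagonal_matrix (\<lambda>i. if i \<in> J then t else 0)" for t :: real
  have lpm_E: "lpm c (E t) = (\<Sum>K\<in>Pow J. c K * t ^ card K)" for t
  proof -
    have "lpm c (E t) = (\<Sum>K\<in>UNIV. c K * (if K \<subseteq> J then t ^ card K else 0))"
      unfolding lpm_def E_def pminor_diagonal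
    proof (intro sum.cong refl arg_cong2[where f = "(*)"])
      fix K :: "'n set"
      show "(\<Prod>i\<in>K. if i \<in> J then t else 0) = (if K \<subseteq> J then t ^ card K else 0)"
      proof (cases "K \<subseteq> J")
        case True
        hence "(\<Prod>i\<in>K. if i \<in> J then t else 0) = (\<Prod>i\<in>K. t)"
          by (intro prod.cong) auto
        thus ?thesis using True by simp
      qed (auto intro!: prod_zero)
    qed simp
    also have "\<dots> = (\<Sum>K\<in>Pow J. c K * t ^ card K)"
      by (rule sum.mono_neutral_cong_right) auto
    finally show ?thesis .
  qed
  have "symmetric_matrix (E 1)"
    by (auto simp: E_def diagonal_matrix_def symmetric_matrix_def transpose_def vec_eq_iff)
  moreover have "2 *\<^sub>R E 1 = E 2"
    by (auto simp: E_def diagonal_matrix_def vec_eq_iff)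
  ultimately have "lpm c (E 2) = 2 ^ d * lpm c (E 1)"
    using hom[of "E 1" 2] by simp
  hence "(\<Sum>K\<in>Pow J. c K * (2 ^ card K - 2 ^ d)) = 0"
    by (simp add: lpm_E sum_distrib_right right_diff_distrib sum_subtractf mult.commute)
  moreover have "(\<Sum>K\<in>Pow J. c K * (2 ^ card K - 2 ^ d)) = (\<Sum>K\<in>{J}. c K * (2 ^ card K - 2 ^ d))"
  proof (rule sum.mono_neutral_right)
    show "\<forall>K\<in>Pow J - {J}. c K * (2 ^ card K - 2 ^ d) = 0"
    proof
      fix K assume "K \<in> Pow J - {J}"
      hence "card K < card J" by (intro psubset_card_mono) auto
      thus "c K * (2 ^ card K - 2 ^ d) = 0" using less[of K] by auto
    qed
  qed auto
  ultimately show ?case by simp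
qed

lemma complex_matrix_line:
  "complex_matrix (X + Re t *\<^sub>R A) (Y + Im t *\<^sub>R A) $ i $ j
    = Complex (X $ i $ j) (Y $ i $ j) + t * of_real (A $ i $ j)"
  by (simp add: complex_matrix_def complex_eq_iff)

text \<open>Hyperbolicity with respect to the identity is PSD-stability for the imaginary parts \<open>a I\<close>.
  Homogeneity over the complex numbers holds because only minors of size \<open>d\<close> occur.\<close>

lemma lpm_hyperbolic_polynomial:
  fixes c :: "'n::finite set \<Rightarrow> real"
  assumes hom: "\<And>t A. symmetric_matrix A \<Longrightarrow> lpm c (t *\<^sub>R A :: real ^ 'n ^ 'n) = t ^ d * lpm c A"
    and stable: "PSD_stable (lpm c)"
    and pos: "lpm c (mat 1 :: real ^ 'n ^ 'n) > 0"
  shows "hyperbolic_polynomial {A :: real ^ 'n ^ 'n. symmetric_matrix A} (lpm c)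
    (\<lambda>X Y. lpm c (complex_matrix X Y)) d (mat 1)"
proof
  show "subspace {A :: real ^ 'n ^ 'n. symmetric_matrix A}"
    by (auto simp: subspace_def symmetric_matrix_def transpose_def vec_eq_iff)
  show "(mat 1 :: real ^ 'n ^ 'n) \<in> {A. symmetric_matrix A}"
    by (simp add: symmetric_matrix_def transpose_mat)
  show "lpm c (complex_matrix X 0) = of_real (lpm c X)" for X :: "real ^ 'n ^ 'n"
    by (simp add: lpm_def pminor_def complex_matrix_def complex_of_real_def[symmetric])
  show "continuous_on UNIV (\<lambda>Z. lpm c (complex_matrix (fst Z) (snd Z :: real ^ 'n ^ 'n)))"
    unfolding lpm_def pminor_def complex_matrix_def Complex_eq
    by (simp, intro continuous_intros)
  show "lpm c (complex_matrix (Re z *\<^sub>R X - Im z *\<^sub>R Y) (Re z *\<^sub>R Y + Im z *\<^sub>R X))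
      = z ^ d * lpm c (complex_matrix X Y)" for z and X Y :: "real ^ 'n ^ 'n"
  proof -
    have "complex_matrix (Re z *\<^sub>R X - Im z *\<^sub>R Y) (Re z *\<^sub>R Y + Im z *\<^sub>R X)
        = (\<chi> i j. z * complex_matrix X Y $ i $ j)"
      by (simp add: complex_matrix_def vec_eq_iff complex_eq_iff)
    moreover have "of_real (c J) * (z ^ card J * w) = z ^ d * (of_real (c J) * w)" for J w
      using homogeneous_lpm_coeff[OF hom, of J] by auto
    ultimately show ?thesis
      by (simp only: lpm_def pminor_scale sum_distrib_left)
  qed
  show "\<exists>p. \<forall>t. lpm c (complex_matrix (X + Re t *\<^sub>R A) (Y + Im t *\<^sub>R A)) = poly p t"
    for X Y A :: "real ^ 'n ^ 'n"
    by (rule exI[of _ "\<Sum>J\<in>UNIV. smult (of_real (c J)) (\<Sum>p | p permutes J. smult (of_int (sign p))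
          (\<Prod>i\<in>J. [:Complex (X $ i $ p i) (Y $ i $ p i), of_real (A $ i $ p i):]))"])
      (simp add: lpm_def pminor_def complex_matrix_line poly_sum poly_prod)
  show "lpm c (complex_matrix X (a *\<^sub>R mat 1)) \<noteq> 0"
    if X: "X \<in> {A. symmetric_matrix A}" and "a > 0" for X :: "real ^ 'n ^ 'n" and a
  proof -
    have "Im_matrix (complex_matrix X (a *\<^sub>R mat 1)) = (a *\<^sub>R mat 1 :: real ^ 'n ^ 'n)"
      by (simp add: Im_matrix_def complex_matrix_def vec_eq_iff)
    moreover have "positive_definite (a *\<^sub>R mat 1 :: real ^ 'n ^ 'n)"
    proof -
      have "v \<bullet> ((a *\<^sub>R mat 1) *v v) > 0" if "v \<noteq> 0" for v :: "real ^ 'n"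
        using \<open>a > 0\<close> that by (simp add: scaleR_matrix_vector_assoc[symmetric])
      moreover have "symmetric_matrix (a *\<^sub>R mat 1 :: real ^ 'n ^ 'n)"
        by (auto simp: symmetric_matrix_def transpose_def mat_def vec_eq_iff)
      ultimately show ?thesis by (simp add: positive_definite_def)
    qed
    moreover have "symmetric_matrix (complex_matrix X (a *\<^sub>R mat 1))"
      using X by (auto simp: symmetric_matrix_def transpose_def complex_matrix_def mat_def vec_eq_iff)
    ultimately show ?thesis
      using stable unfolding PSD_stable_def by metis
  qed
  show "lpm c (mat 1 :: real ^ 'n ^ 'n) > 0" by fact
qed

section \<open>Sign flips and block projections\<close>

text \<open>Conjugation of \<open>A\<close> by the diagonal matrix with entry \<open>- 1\<close> on \<open>S\<close> and \<open>1\<close> elsewhere.\<close>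

definition flip_signs :: "'n set \<Rightarrow> real ^ 'n ^ 'n \<Rightarrow> real ^ 'n ^ 'n" where
  "flip_signs S A = (\<chi> i j. if i \<in> S \<longleftrightarrow> j \<in> S then A $ i $ j else - A $ i $ j)"

text \<open>Each entry of a term of the Leibniz formula picks up a row sign and a column sign; over all of \<open>J\<close>
  the sign of every index occurs twice, once in each role.\<close>

lemma pminor_flip_signs:
  fixes A :: "real ^ 'n::finite ^ 'n"
  shows "pminor J (flip_signs S A) = pminor J A"
  unfolding pminor_def
proof (intro sum.cong refl arg_cong2[where f = "(*)"])
  fix p assume "p \<in> {p. p permutes J}"
  hence p: "p permutes J" by simp
  define \<sigma> :: "'n \<Rightarrow> real" where "\<sigma> i = (if i \<in> S then -1 else 1)" for i
  have "(\<Prod>i\<in>J. flip_signs S A $ i $ p i) = (\<Prod>i\<in>J. \<sigma> i * \<sigma> (p i) * A $ i $ p i)"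
    by (intro prod.cong) (auto simp: flip_signs_def \<sigma>_def)
  also have "\<dots> = (\<Prod>i\<in>J. \<sigma> i) * (\<Prod>i\<in>J. \<sigma> (p i)) * (\<Prod>i\<in>J. A $ i $ p i)"
    by (simp add: prod.distrib)
  also have "(\<Prod>i\<in>J. \<sigma> (p i)) = (\<Prod>i\<in>J. \<sigma> i)"
    using prod.permute[OF p, of \<sigma>] by (simp add: o_def)
  also have "(\<Prod>i\<in>J. \<sigma> i) * (\<Prod>i\<in>J. \<sigma> i) = (\<Prod>i\<in>J. \<sigma> i * \<sigma> i)"
    by (simp add: prod.distrib)
  also have "\<dots> = 1"
    by (intro prod.neutral) (auto simp: \<sigma>_def)
  finally show "(\<Prod>i\<in>J. flip_signs S A $ i $ p i) = (\<Prod>i\<in>J. A $ i $ p i)"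
    by simp
qed

lemma lpm_flip_signs: "lpm c (flip_signs S A) = lpm c (A :: real ^ 'n::finite ^ 'n)"
  by (simp add: lpm_def pminor_flip_signs)

lemma symmetric_flip_signs: "symmetric_matrix A \<Longrightarrow> symmetric_matrix (flip_signs S A)"
  by (auto simp: flip_signs_def symmetric_matrix_def transpose_def vec_eq_iff)

lemma flip_signs_add_mat: "flip_signs S (A + t *\<^sub>R mat 1) = flip_signs S A + t *\<^sub>R mat 1"
  by (auto simp: flip_signs_def mat_def vec_eq_iff)

text \<open>The entries that survive when the index set is separated along every \<open>S \<in> \<T>\<close>. Unlike
  \<^const>\<open>block_proj\<close>, it makes sense for a part of the blocks of a partition, and so the blocks can be
  treated one at a time.\<close>

definition cut :: "'n set set \<Rightarrow> real ^ 'n ^ 'n \<Rightarrow> real ^ 'n ^ 'n" where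
  "cut \<T> A = (\<chi> i j. if \<forall>S\<in>\<T>. i \<in> S \<longleftrightarrow> j \<in> S then A $ i $ j else 0)"

lemma cut_empty: "cut {} A = A"
  by (simp add: cut_def vec_eq_iff)

text \<open>Averaging with the sign flip for \<open>S\<close> kills the entries with exactly one index in \<open>S\<close> and keeps all
  others.\<close>

lemma cut_insert: "cut (insert S \<T>) A = (1/2) *\<^sub>R (cut \<T> A + flip_signs S (cut \<T> A))"
  by (auto simp: cut_def flip_signs_def vec_eq_iff)

lemma block_proj_eq_cut:
  assumes "partition_on UNIV \<S>"
  shows "block_proj \<S> A = cut \<S> A"
proof -
  have "same_block \<S> i j \<longleftrightarrow> (\<forall>S\<in>\<S>. i \<in> S \<longleftrightarrow> j \<in> S)" for i j
  proof
    assume "same_block \<S> i j"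
    then obtain T where T: "T \<in> \<S>" "i \<in> T" "j \<in> T"
      by (auto simp: same_block_def)
    have "S = T" if "S \<in> \<S>" "i \<in> S \<or> j \<in> S" for S
      using disjointD[OF partition_onD2[OF assms] that(1) T(1)] that(2) T by auto
    thus "\<forall>S\<in>\<S>. i \<in> S \<longleftrightarrow> j \<in> S"
      using T by blast
  next
    assume "\<forall>S\<in>\<S>. i \<in> S \<longleftrightarrow> j \<in> S"
    moreover obtain T where "T \<in> \<S>" "i \<in> T"
      using partition_onD1[OF assms] by blast
    ultimately show "same_block \<S> i j"
      unfolding same_block_def by blast
  qed
  thus ?thesis by (simp add: block_proj_def cut_def)
qed

theorem theorem2p4:
  fixes c :: "'n::finite set \<Rightarrow> real" and \<S> :: "'n set set" and A :: "real ^ 'n ^ 'n"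
  assumes "homogeneous (lpm c)"
    and "PSD_stable (lpm c)"
    and "lpm c (mat 1 :: real ^ 'n ^ 'n) > 0"
    and "partition_on UNIV \<S>"
    and "A \<in> hyp_cone (lpm c)"
  shows "lpm c (block_proj \<S> A) \<ge> lpm c A"
proof -
  obtain d where hom: "\<And>t A. symmetric_matrix A \<Longrightarrow> lpm c (t *\<^sub>R A :: real ^ 'n ^ 'n) = t ^ d * lpm c A"
    using assms(1) unfolding homogeneous_def by blast
  interpret hyperbolic_polynomial "{A :: real ^ 'n ^ 'n. symmetric_matrix A}" "lpm c"
    "\<lambda>X Y. lpm c (complex_matrix X Y)" d "mat 1"
    by (rule lpm_hyperbolic_polynomial[OF hom assms(2,3)])
  have flip: "flip_signs S B \<in> hyperbolicity_cone" if "B \<in> hyperbolicity_cone" for S B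
    using that
    by (simp add: hyperbolicity_cone_def lpm_flip_signs symmetric_flip_signs
        flip: flip_signs_add_mat)
  have "A \<in> hyperbolicity_cone"
  proof -
    have "lpm c (A + s *\<^sub>R mat 1) \<noteq> 0" if "s > 0" for s
    proof -
      have eq: "A - mat (- s) = A + s *\<^sub>R mat 1"
        by (simp add: vec_eq_iff mat_def)
      have "lpm c (A - mat (- s)) = 0 \<Longrightarrow> - s \<ge> 0"
        using assms(5) unfolding hyp_cone_def by blast
      thus ?thesis
        using that unfolding eq by auto
    qed
    thus ?thesis
      using assms(5) by (simp add: hyperbolicity_cone_def hyp_cone_def)
  qed
  have "cut \<T> A \<in> hyperbolicity_cone \<and> lpm c A \<le> lpm c (cut \<T> A)" if "finite \<T>" for \<T>
    using that
  proof induction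
    case empty
    show ?case using \<open>A \<in> hyperbolicity_cone\<close> by (simp add: cut_empty)
  next
    case (insert S \<T>)
    let ?B = "cut \<T> A" and ?C = "cut (insert S \<T>) A"
    have B: "?B \<in> hyperbolicity_cone" "lpm c A \<le> lpm c ?B"
      using insert.IH by auto
    have C: "?C \<in> hyperbolicity_cone"
      using cone_combination[OF B(1) flip[OF B(1)], of "1/2" "1/2" S]
      by (simp add: cut_insert scaleR_add_right)
    have "(lpm c ?B)\<^sup>2 \<le> (lpm c ?C)\<^sup>2"
      using midpoint_log_concave[OF B(1) flip[OF B(1)], of S]
      by (simp add: cut_insert lpm_flip_signs power2_eq_square)
    hence "lpm c ?B \<le> lpm c ?C"
      using P_nonneg[OF C] by (rule power2_le_imp_le)
    thus ?case using B C by simp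
  qed
  thus ?thesis
    by (simp add: block_proj_eq_cut[OF assms(4)])
qed

end
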